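(* Let $\alpha>0$ and let $\phi(z)=\phi(0)+\lambda z$, where $\phi(0),\lambda\in\mathbb C$. (i) For $0<m\le 1$, $C_\phi$ is bounded on $F^2_{\alpha,m}(\mathbb C)$ if and only if $|\lambda|\le 1$. (ii) For $m>1$, $C_\phi$ is bounded on $F^2_{\alpha,m}(\mathbb C)$ if and only if either $|\lambda|<1$, or $|\lambda|=1$ with $\phi(0)=0$.
   Context: For $m>0$ and $\alpha>0$, the weighted Fock space $F^2_{\alpha,m}(\mathbb C)$ is the Hilbert space of all entire functions on $\mathbb C$ that are square integrable with respect to the measure $d\mu_{\alpha,m}(z)=\frac{m\alpha^{2/m}}{2\pi\Gamma(2/m)}e^{-\alpha|z|^m}\,dA(z)$, where $dA$ is Lebesgue measure on $\mathbb C$ and $\Gamma$ is the Euler gamma function; its inner product is $\langle f,g\rangle_{\alpha,m}=\int_{\mathbb C} f\overline{g}\,d\mu_{\alpha,m}$ and its norm is $\|\cdot\|_{\alpha,m}$. For an entire function $\phi$, the composition operator is $C_\phi f=f\circ\phi$. Saying that it is bounded on $F^2_{\alpha,m}(\mathbb C)$ means that it maps $F^2_{\alpha,m}(\mathbb C)$ into itself and is a bounded linear operator there. *)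

theory Defs
  imports "HOL-Complex_Analysis.Complex_Analysis"
begin

definition fock_measure :: "real \<Rightarrow> real \<Rightarrow> complex measure" where
  "fock_measure \<alpha> m = density lborel (\<lambda>z. ennreal
     (m * \<alpha> powr (2 / m) / (2 * pi * Gamma (2 / m)) * exp (- \<alpha> * cmod z powr m)))"

definition fock_space :: "real \<Rightarrow> real \<Rightarrow> (complex \<Rightarrow> complex) set" where
  "fock_space \<alpha> m =
     {f. f holomorphic_on UNIV \<and> integrable (fock_measure \<alpha> m) (\<lambda>z. (cmod (f z))\<^sup>2)}"

definition fock_inner :: "real \<Rightarrow> real \<Rightarrow> (complex \<Rightarrow> complex) \<Rightarrow> (complex \<Rightarrow> complex) \<Rightarrow> complex" where
  "fock_inner \<alpha> m f g = (LINT z|fock_measure \<alpha> m. f z * cnj (g z))"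

definition fock_norm :: "real \<Rightarrow> real \<Rightarrow> (complex \<Rightarrow> complex) \<Rightarrow> real" where
  "fock_norm \<alpha> m f = sqrt (Re (fock_inner \<alpha> m f f))"

definition comp_op :: "(complex \<Rightarrow> complex) \<Rightarrow> (complex \<Rightarrow> complex) \<Rightarrow> (complex \<Rightarrow> complex)" where
  "comp_op \<phi> f = f \<circ> \<phi>"

text \<open>The space depends on the real parameters \<open>\<alpha>\<close> and \<open>m\<close>, so it is a carrier set rather than a
  type, and the library predicate \<^const>\<open>bounded_linear\<close> does not apply; its clauses are written
  out relative to the carrier.\<close>

definition bounded_on_fock ::
    "real \<Rightarrow> real \<Rightarrow> ((complex \<Rightarrow> complex) \<Rightarrow> (complex \<Rightarrow> complex)) \<Rightarrow> bool" where
  "bounded_on_fock \<alpha> m T \<longleftrightarrow>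
     (\<forall>f\<in>fock_space \<alpha> m. T f \<in> fock_space \<alpha> m) \<and>
     (\<forall>f\<in>fock_space \<alpha> m. \<forall>g\<in>fock_space \<alpha> m. T (\<lambda>z. f z + g z) = (\<lambda>z. T f z + T g z)) \<and>
     (\<forall>f\<in>fock_space \<alpha> m. \<forall>c. T (\<lambda>z. c * f z) = (\<lambda>z. c * T f z)) \<and>
     (\<exists>K. \<forall>f\<in>fock_space \<alpha> m. fock_norm \<alpha> m (T f) \<le> K * fock_norm \<alpha> m f)"

end

theory Submission
  imports Defs "HOL-Real_Asymp.Real_Asymp"
begin

text \<open>
  Write \<open>a = \<phi> 0\<close> and let \<open>l \<noteq> 0\<close>. Up to a positive constant, the squared norm of \<open>f\<close> is the
  integral of \<open>|f|\<^sup>2\<close> against the weight \<open>exp (- \<alpha> |w|^m)\<close>, and the substitution \<open>w = a + l z\<close>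
  turns the squared norm of \<open>f \<circ> \<phi>\<close> into \<open>1 / |l|\<^sup>2\<close> times the integral of the same \<open>|f|\<^sup>2\<close> against
  \<open>exp (- \<alpha> (|w - a| / |l|)^m)\<close>. Everything is therefore a comparison of the exponents \<open>|w|^m\<close> and
  \<open>(|w - a| / |l|)^m\<close>.

  If \<open>|w|^m - (|w - a| / |l|)^m\<close> is bounded above, the ratio of the weights is bounded and so is the
  operator. This happens for \<open>|l| \<le> 1\<close> when \<open>m \<le> 1\<close>, because then the power \<open>m\<close> is subadditive, for
  \<open>|l| < 1\<close> and every \<open>m\<close>, because then \<open>|w - a| / |l| \<ge> |w|\<close> for large \<open>w\<close>, and trivially for
  \<open>|l| = 1\<close>, \<open>a = 0\<close>. In the degenerate case \<open>l = 0\<close> the operator is evaluation at \<open>a\<close>, which is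
  controlled by the area mean value inequality for the entire function \<open>f\<^sup>2\<close>.

  For the converse the monomials suffice as test functions, although \<open>|w ^ n|\<close> is radial and the
  difference of exponents is large only for \<open>w\<close> pointing roughly in the direction of \<open>a\<close>. Summing
  the second weight over the four rotations \<open>w \<mapsto> i^k w\<close> repairs this: one of them always turns \<open>w\<close>
  sufficiently towards \<open>a\<close> to give \<open>|i^k w - a| \<le> |w| - |a|/4\<close> once \<open>|w| \<ge> 2 |a|\<close>. If
  \<open>r^m - ((r - |a|/4) / |l|)^m\<close> tends to infinity, which is the case when \<open>|l| > 1\<close>, and also when
  \<open>|l| = 1\<close>, \<open>a \<noteq> 0\<close> and \<open>m > 1\<close>, the summed weight exceeds any multiple of \<open>exp (- \<alpha> |w|^m)\<close> far
  out. Since the mass of \<open>|w ^ n|\<^sup>2\<close> moves to infinity as \<open>n\<close> grows, no bound can hold for all \<open>n\<close>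
  (\<open>fock_energy_comp_affine_monomials_unbounded\<close>).
\<close>

section \<open>Lebesgue measure under complex affine maps\<close>

lemma nn_integral_lborel_translate:
  fixes F :: "'a::euclidean_space \<Rightarrow> ennreal"
  assumes [measurable]: "F \<in> borel_measurable borel"
  shows "(\<integral>\<^sup>+z. F (c + z) \<partial>lborel) = (\<integral>\<^sup>+z. F z \<partial>lborel)"
proof -
  have "(\<integral>\<^sup>+z. F z \<partial>lborel) = (\<integral>\<^sup>+z. F z \<partial>distr lborel borel ((+) c))"
    by (simp add: lborel_distr_plus)
  also have "\<dots> = (\<integral>\<^sup>+z. F (c + z) \<partial>lborel)"
    by (subst nn_integral_distr) auto
  finally show ?thesis by simp
qed

text \<open>This is the uniqueness argument for Haar measure, which avoids determinants: multiply the left side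
  by the area of the unit disc \<open>B\<close>, spread \<open>F\<close> over translates by the points of \<open>B\<close>, and apply
  Fubini twice. Translation invariance then leaves the integral of \<open>F\<close> times the area of
  \<open>{z. l z \<in> B}\<close>, which is a disc of radius \<open>1 / |l|\<close>.\<close>

lemma nn_integral_lborel_complex_mult:
  fixes F :: "complex \<Rightarrow> ennreal"
  assumes [measurable]: "F \<in> borel_measurable borel" and l: "l \<noteq> 0"
  shows "(\<integral>\<^sup>+z. F (l * z) \<partial>lborel) = ennreal (1 / (cmod l)\<^sup>2) * (\<integral>\<^sup>+z. F z \<partial>lborel)"
proof -
  define B where "B = (indicator (ball 0 1) :: complex \<Rightarrow> ennreal)"
  have [measurable]: "B \<in> borel_measurable borel"
    unfolding B_def by (intro borel_measurable_indicator) simp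
  have B1: "(\<integral>\<^sup>+x. B x \<partial>lborel) = ennreal (unit_ball_vol 2)"
    unfolding B_def by (simp add: emeasure_ball)
  have Bl: "(\<integral>\<^sup>+z. B (- (l * z)) \<partial>lborel) = ennreal (unit_ball_vol 2) * ennreal (1 / (cmod l)\<^sup>2)"
  proof -
    have "(\<lambda>z. B (- (l * z))) = indicator (ball 0 (1 / cmod l))"
      using l by (auto simp: B_def indicator_def norm_mult field_simps)
    then show ?thesis
      by (simp add: emeasure_ball ennreal_mult[symmetric] power_divide)
  qed
  have "ennreal (unit_ball_vol 2) * (\<integral>\<^sup>+z. F (l * z) \<partial>lborel)
      = (\<integral>\<^sup>+x. B x * (\<integral>\<^sup>+z. F (l * z) \<partial>lborel) \<partial>lborel)"
    by (simp add: nn_integral_multc B1)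
  also have "\<dots> = (\<integral>\<^sup>+x. (\<integral>\<^sup>+z. B x * F (x + l * z) \<partial>lborel) \<partial>lborel)"
  proof (rule nn_integral_cong)
    fix x :: complex
    have "(\<integral>\<^sup>+z. F (l * z) \<partial>lborel) = (\<integral>\<^sup>+z. F (l * (x / l + z)) \<partial>lborel)"
      by (rule nn_integral_lborel_translate[symmetric]) measurable
    also have "\<dots> = (\<integral>\<^sup>+z. F (x + l * z) \<partial>lborel)"
      using l by (simp add: distrib_left)
    finally show "B x * (\<integral>\<^sup>+z. F (l * z) \<partial>lborel) = (\<integral>\<^sup>+z. B x * F (x + l * z) \<partial>lborel)"
      by (simp add: nn_integral_cmult)
  qed
  also have "\<dots> = (\<integral>\<^sup>+z. (\<integral>\<^sup>+x. B x * F (x + l * z) \<partial>lborel) \<partial>lborel)"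
    by (rule lborel_pair.Fubini') measurable
  also have "\<dots> = (\<integral>\<^sup>+z. (\<integral>\<^sup>+x. B (x - l * z) * F x \<partial>lborel) \<partial>lborel)"
  proof (rule nn_integral_cong)
    fix z :: complex
    show "(\<integral>\<^sup>+x. B x * F (x + l * z) \<partial>lborel) = (\<integral>\<^sup>+x. B (x - l * z) * F x \<partial>lborel)"
      by (subst nn_integral_lborel_translate[of "\<lambda>x. B (x - l * z) * F x" "l * z", symmetric])
         (simp_all add: add.commute)
  qed
  also have "\<dots> = (\<integral>\<^sup>+x. (\<integral>\<^sup>+z. B (x - l * z) * F x \<partial>lborel) \<partial>lborel)"
    by (rule lborel_pair.Fubini') measurable
  also have "\<dots> = (\<integral>\<^sup>+x. (\<integral>\<^sup>+z. B (- (l * z)) \<partial>lborel) * F x \<partial>lborel)"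
  proof (rule nn_integral_cong)
    fix x :: complex
    have "(\<integral>\<^sup>+z. B (x - l * z) \<partial>lborel) = (\<integral>\<^sup>+z. B (x - l * (x / l + z)) \<partial>lborel)"
      by (rule nn_integral_lborel_translate[symmetric]) measurable
    also have "\<dots> = (\<integral>\<^sup>+z. B (- (l * z)) \<partial>lborel)"
      using l by (simp add: distrib_left)
    finally show "(\<integral>\<^sup>+z. B (x - l * z) * F x \<partial>lborel) = (\<integral>\<^sup>+z. B (- (l * z)) \<partial>lborel) * F x"
      by (simp add: nn_integral_multc)
  qed
  also have "\<dots> = ennreal (unit_ball_vol 2) * (ennreal (1 / (cmod l)\<^sup>2) * (\<integral>\<^sup>+z. F z \<partial>lborel))"
    by (simp add: nn_integral_cmult Bl mult.assoc)
  finally show ?thesis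
    by (subst (asm) ennreal_mult_cancel_left) (auto simp: unit_ball_vol_2)
qed


section \<open>The area mean value inequality\<close>

text \<open>Cauchy's formula on the unit circle for \<open>u \<mapsto> h (a + u z)\<close>; putting the radius and the phase of \<open>z\<close>
  into the function gives the bound for all circles about \<open>a\<close> at once.\<close>

lemma norm_le_nn_integral_circle:
  assumes h: "h holomorphic_on UNIV"
  shows "ennreal (cmod (h a)) \<le>
    (\<integral>\<^sup>+t. indicator {0..1} t * ennreal (cmod (h (a + exp (2 * pi * \<i> * of_real t) * z))) \<partial>lborel)"
proof -
  define g where "g = (\<lambda>t::real. h (a + exp (2 * pi * \<i> * of_real t) * z))"
  have conth: "continuous_on UNIV h"
    using h holomorphic_on_imp_continuous_on by blast
  have contg: "continuous_on A g" for A
    unfolding g_def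
    by (intro continuous_on_compose2[OF conth] continuous_intros) auto
  have [measurable]: "g \<in> borel_measurable borel"
    by (intro borel_measurable_continuous_onI contg)
  have "h \<circ> (\<lambda>u. a + u * z) holomorphic_on cball 0 1"
    by (intro holomorphic_on_compose_gen[OF _ h] holomorphic_intros) auto
  then have hol: "(\<lambda>u. h (a + u * z)) holomorphic_on cball 0 1"
    by (simp add: o_def)
  have "((\<lambda>u. h (a + u * z) / (u - 0)) has_contour_integral (2 * of_real pi * \<i> * h (a + 0 * z)))
      (circlepath 0 1)"
    by (rule Cauchy_integral_circlepath_simple[OF hol]) simp
  then have "((\<lambda>t. 2 * of_real pi * \<i> * g t) has_integral (2 * of_real pi * \<i> * h a)) {0..1}"
    unfolding has_contour_integral_def mult_zero_left add_0_right
    by (rule has_integral_eq[rotated]) (subst vector_derivative_circlepath01, simp_all add: circlepath g_def)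
  then have "(g has_integral h a) {0..1}"
    by (subst (asm) has_integral_mult_right_iff) simp_all
  then have "h a = integral {0..1} g"
    by (simp add: integral_unique)
  then have "cmod (h a) \<le> integral {0..1} (\<lambda>t. cmod (g t))"
    by (auto intro!: integral_norm_bound_integral integrable_continuous_interval
        continuous_intros contg)
  moreover have "((\<lambda>t. cmod (g t)) has_integral (integral {0..1} (\<lambda>t. cmod (g t)))) {0..1}"
    by (intro integrable_integral integrable_continuous_interval continuous_intros contg)
  then have "((\<lambda>t. if t \<in> {0..1} then cmod (g t) else 0) has_integral
      (integral {0..1} (\<lambda>t. cmod (g t)))) UNIV"
    by (simp only: has_integral_restrict_UNIV)
  then have "((\<lambda>t. indicator {0..1} t * cmod (g t)) has_integral
      (integral {0..1} (\<lambda>t. cmod (g t)))) UNIV"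
    by (rule has_integral_eq[rotated]) (auto simp: indicator_def)
  then have "(\<integral>\<^sup>+t. ennreal (indicator {0..1} t * cmod (g t)) \<partial>lborel)
      = ennreal (integral {0..1} (\<lambda>t. cmod (g t)))"
    by (intro nn_integral_has_integral_lborel) simp_all
  moreover have "ennreal (indicator {0..1} t * x) = indicator {0..1} t * ennreal x" for t x :: real
    by (auto simp: indicator_def)
  ultimately show ?thesis
    unfolding g_def by (simp add: ennreal_leI)
qed

text \<open>Polar coordinates are replaced by rotation invariance: the disc integral is unchanged when its
  integrand is rotated, hence equals the average over all rotations, and for each fixed \<open>z\<close> that
  average is a circle mean.\<close>

lemma norm_le_nn_integral_ball:
  assumes h: "h holomorphic_on UNIV"
  shows "ennreal pi * ennreal (cmod (h a)) \<le>
    (\<integral>\<^sup>+z. indicator (ball a 1) z * ennreal (cmod (h z)) \<partial>lborel)"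
proof -
  define B where "B = (indicator (ball 0 1) :: complex \<Rightarrow> ennreal)"
  have [measurable]: "B \<in> borel_measurable borel"
    unfolding B_def by (intro borel_measurable_indicator) simp
  have [measurable]: "h \<in> borel_measurable borel"
    using h by (intro borel_measurable_continuous_onI holomorphic_on_imp_continuous_on)
  let ?e = "\<lambda>t::real. exp (2 * pi * \<i> * of_real t)"
  have [measurable]: "?e \<in> borel_measurable borel"
    by (intro borel_measurable_continuous_onI continuous_intros)
  have "ennreal pi * ennreal (cmod (h a)) = (\<integral>\<^sup>+z. B z * ennreal (cmod (h a)) \<partial>lborel)"
    by (subst nn_integral_multc) (simp_all add: emeasure_ball unit_ball_vol_2, simp_all add: B_def emeasure_ball unit_ball_vol_2)
  also have "\<dots> \<le> (\<integral>\<^sup>+z. \<integral>\<^sup>+t. B z *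
      (indicator {0..1} t * ennreal (cmod (h (a + ?e t * z)))) \<partial>lborel \<partial>lborel)"
    by (subst nn_integral_cmult, measurable)
       (intro nn_integral_mono mult_left_mono norm_le_nn_integral_circle h, simp)
  also have "\<dots> = (\<integral>\<^sup>+t. \<integral>\<^sup>+z. B z *
      (indicator {0..1} t * ennreal (cmod (h (a + ?e t * z)))) \<partial>lborel \<partial>lborel)"
    by (rule lborel_pair.Fubini') measurable
  also have "\<dots> = (\<integral>\<^sup>+t. indicator {0..1::real} t * (\<integral>\<^sup>+z. B z * ennreal (cmod (h (a + z))) \<partial>lborel) \<partial>lborel)"
  proof (rule nn_integral_cong)
    fix t :: real
    have e: "cmod (?e t) = 1" by simp
    have "(\<integral>\<^sup>+z. B z * (indicator {0..1} t * ennreal (cmod (h (a + ?e t * z)))) \<partial>lborel)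
        = (\<integral>\<^sup>+z. indicator {0..1} t * (B (?e t * z) * ennreal (cmod (h (a + ?e t * z)))) \<partial>lborel)"
      by (intro nn_integral_cong) (auto simp: B_def indicator_def norm_mult)
    also have "\<dots> = indicator {0..1} t *
        (\<integral>\<^sup>+z. B (?e t * z) * ennreal (cmod (h (a + ?e t * z))) \<partial>lborel)"
      by (intro nn_integral_cmult) measurable
    also have "(\<integral>\<^sup>+z. B (?e t * z) * ennreal (cmod (h (a + ?e t * z))) \<partial>lborel)
        = (\<integral>\<^sup>+z. B z * ennreal (cmod (h (a + z))) \<partial>lborel)"
      by (subst nn_integral_lborel_complex_mult[of "\<lambda>z. B z * ennreal (cmod (h (a + z)))" "?e t"])
         (simp_all add: e)
    finally show "(\<integral>\<^sup>+z. B z * (indicator {0..1} t * ennreal (cmod (h (a + ?e t * z)))) \<partial>lborel)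
        = indicator {0..1} t * (\<integral>\<^sup>+z. B z * ennreal (cmod (h (a + z))) \<partial>lborel)" .
  qed
  also have "\<dots> = (\<integral>\<^sup>+z. B z * ennreal (cmod (h (a + z))) \<partial>lborel)"
    by (subst nn_integral_multc) simp_all
  also have "\<dots> = (\<integral>\<^sup>+z. indicator (ball a 1) (a + z) * ennreal (cmod (h (a + z))) \<partial>lborel)"
    by (intro nn_integral_cong) (auto simp: B_def indicator_def dist_norm)
  also have "\<dots> = (\<integral>\<^sup>+z. indicator (ball a 1) z * ennreal (cmod (h z)) \<partial>lborel)"
    by (rule nn_integral_lborel_translate) (auto intro!: borel_measurable_times_ennreal borel_measurable_indicator)
  finally show ?thesis .
qed

section \<open>Boundedness as an energy estimate\<close>

text \<open>The squared norm without its normalising constant, as an extended nonnegative number, so that it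
  makes sense before membership in the space is known.\<close>

definition fock_energy :: "real \<Rightarrow> real \<Rightarrow> (complex \<Rightarrow> complex) \<Rightarrow> ennreal" where
  "fock_energy \<alpha> m f = (\<integral>\<^sup>+z. ennreal ((cmod (f z))\<^sup>2 * exp (- \<alpha> * cmod z powr m)) \<partial>lborel)"

lemma borel_measurable_entire:
  assumes "f holomorphic_on UNIV"
  shows "f \<in> borel_measurable borel"
  using assms by (intro borel_measurable_continuous_onI holomorphic_on_imp_continuous_on)

lemma fock_constant_pos:
  assumes "\<alpha> > 0" "m > 0"
  shows "m * \<alpha> powr (2 / m) / (2 * pi * Gamma (2 / m)) > (0::real)"
  using assms by (intro divide_pos_pos mult_pos_pos Gamma_real_pos) auto

lemma nn_integral_fock_measure:
  assumes "\<alpha> > 0" "m > 0" and f: "f holomorphic_on UNIV"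
  shows "(\<integral>\<^sup>+z. ennreal ((cmod (f z))\<^sup>2) \<partial>fock_measure \<alpha> m) =
    ennreal (m * \<alpha> powr (2 / m) / (2 * pi * Gamma (2 / m))) * fock_energy \<alpha> m f"
proof -
  define c where "c = m * \<alpha> powr (2 / m) / (2 * pi * Gamma (2 / m))"
  have c: "c > 0" unfolding c_def by (rule fock_constant_pos) fact+
  note [measurable] = borel_measurable_entire[OF f]
  have "(\<integral>\<^sup>+z. ennreal ((cmod (f z))\<^sup>2) \<partial>fock_measure \<alpha> m) =
      (\<integral>\<^sup>+z. ennreal (c * exp (- \<alpha> * cmod z powr m)) * ennreal ((cmod (f z))\<^sup>2) \<partial>lborel)"
    unfolding fock_measure_def c_def by (rule nn_integral_density) measurable
  also have "\<dots> = (\<integral>\<^sup>+z. ennreal c * ennreal ((cmod (f z))\<^sup>2 * exp (- \<alpha> * cmod z powr m)) \<partial>lborel)"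
    using c by (intro nn_integral_cong) (simp add: ennreal_mult[symmetric] mult_ac)
  also have "\<dots> = ennreal c * fock_energy \<alpha> m f"
    unfolding fock_energy_def by (rule nn_integral_cmult) measurable
  finally show ?thesis unfolding c_def .
qed

lemma mem_fock_space_iff:
  assumes "\<alpha> > 0" "m > 0" and f: "f holomorphic_on UNIV"
  shows "f \<in> fock_space \<alpha> m \<longleftrightarrow> fock_energy \<alpha> m f < \<infinity>"
proof -
  define c where "c = m * \<alpha> powr (2 / m) / (2 * pi * Gamma (2 / m))"
  have c: "c > 0" unfolding c_def by (rule fock_constant_pos) fact+
  note [measurable] = borel_measurable_entire[OF f]
  have meas: "(\<lambda>z. (cmod (f z))\<^sup>2) \<in> borel_measurable (fock_measure \<alpha> m)"
    unfolding fock_measure_def by simp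
  have "f \<in> fock_space \<alpha> m \<longleftrightarrow> (\<integral>\<^sup>+z. ennreal ((cmod (f z))\<^sup>2) \<partial>fock_measure \<alpha> m) < \<infinity>"
    using f meas by (simp add: fock_space_def integrable_iff_bounded)
  also have "\<dots> \<longleftrightarrow> fock_energy \<alpha> m f < \<infinity>"
    unfolding nn_integral_fock_measure[OF assms] c_def[symmetric]
    using c by (auto simp: ennreal_mult_less_top)
  finally show ?thesis .
qed

lemma fock_norm_eq:
  assumes "\<alpha> > 0" "m > 0" and f: "f holomorphic_on UNIV"
  shows "fock_norm \<alpha> m f =
    sqrt (m * \<alpha> powr (2 / m) / (2 * pi * Gamma (2 / m)) * enn2real (fock_energy \<alpha> m f))"
proof -
  note [measurable] = borel_measurable_entire[OF f]
  have meas: "(\<lambda>z. (cmod (f z))\<^sup>2) \<in> borel_measurable (fock_measure \<alpha> m)"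
    unfolding fock_measure_def by simp
  have "fock_inner \<alpha> m f f = (LINT z|fock_measure \<alpha> m. complex_of_real ((cmod (f z))\<^sup>2))"
    unfolding fock_inner_def by (simp add: complex_norm_square[symmetric] del: of_real_power)
  then have "Re (fock_inner \<alpha> m f f) = (LINT z|fock_measure \<alpha> m. (cmod (f z))\<^sup>2)"
    by (simp only: integral_complex_of_real Re_complex_of_real)
  also have "\<dots> = enn2real (\<integral>\<^sup>+z. ennreal ((cmod (f z))\<^sup>2) \<partial>fock_measure \<alpha> m)"
    by (intro integral_eq_nn_integral meas) simp
  finally show ?thesis
    using fock_constant_pos[OF assms(1,2)]
    by (simp add: fock_norm_def nn_integral_fock_measure[OF assms] enn2real_mult)
qed

text \<open>Linearity of a composition operator is automatic, and an energy estimate with finite right side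
  already forces the operator to map the space into itself.\<close>

lemma bounded_on_fock_comp_op_iff:
  assumes pos: "\<alpha> > 0" "m > 0" and \<phi>: "\<phi> holomorphic_on UNIV"
  shows "bounded_on_fock \<alpha> m (comp_op \<phi>) \<longleftrightarrow>
    (\<exists>K::real. \<forall>f. f holomorphic_on UNIV \<longrightarrow> fock_energy \<alpha> m f < \<infinity> \<longrightarrow>
        fock_energy \<alpha> m (f \<circ> \<phi>) \<le> ennreal K * fock_energy \<alpha> m f)"
    (is "?L \<longleftrightarrow> ?R")
proof -
  define c where "c = m * \<alpha> powr (2 / m) / (2 * pi * Gamma (2 / m))"
  have c: "c > 0" unfolding c_def by (rule fock_constant_pos) fact+
  have hol: "f \<circ> \<phi> holomorphic_on UNIV" if "f holomorphic_on UNIV" for f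
    by (rule holomorphic_on_compose_gen[OF \<phi> that]) simp
  have space: "f \<in> fock_space \<alpha> m \<longleftrightarrow> f holomorphic_on UNIV \<and> fock_energy \<alpha> m f < \<infinity>" for f
    using mem_fock_space_iff[OF pos] by (auto simp: fock_space_def)
  note norm = fock_norm_eq[OF pos, folded c_def]
  show ?thesis
  proof
    assume ?L
    then obtain K where
      K: "\<And>f. f \<in> fock_space \<alpha> m \<Longrightarrow> fock_norm \<alpha> m (f \<circ> \<phi>) \<le> K * fock_norm \<alpha> m f"
      and into: "\<And>f. f \<in> fock_space \<alpha> m \<Longrightarrow> f \<circ> \<phi> \<in> fock_space \<alpha> m"
      unfolding bounded_on_fock_def comp_op_def by blast
    show ?R
    proof (intro exI[of _ "K\<^sup>2"] allI impI)
      fix f assume f: "f holomorphic_on UNIV" "fock_energy \<alpha> m f < \<infinity>"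
      let ?x = "enn2real (fock_energy \<alpha> m f)" and ?y = "enn2real (fock_energy \<alpha> m (f \<circ> \<phi>))"
      have "fock_energy \<alpha> m (f \<circ> \<phi>) < \<infinity>"
        using into[of f] f by (simp add: space)
      then have fin: "fock_energy \<alpha> m f = ennreal ?x" "fock_energy \<alpha> m (f \<circ> \<phi>) = ennreal ?y"
        using f by simp_all
      have "sqrt (c * ?y) \<le> K * sqrt (c * ?x)"
        using K[of f] f by (simp add: space norm hol)
      then have "(sqrt (c * ?y))\<^sup>2 \<le> (K * sqrt (c * ?x))\<^sup>2"
        using c by (intro power_mono) auto
      then have "?y \<le> K\<^sup>2 * ?x"
        using c by (simp add: power_mult_distrib)
      then have "ennreal ?y \<le> ennreal (K\<^sup>2 * ?x)"
        by (rule ennreal_leI)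
      also have "\<dots> = ennreal (K\<^sup>2) * ennreal ?x"
        by (intro ennreal_mult) simp_all
      finally show "fock_energy \<alpha> m (f \<circ> \<phi>) \<le> ennreal (K\<^sup>2) * fock_energy \<alpha> m f"
        by (simp only: fin[symmetric])
    qed
  next
    assume ?R
    then obtain K where K: "\<And>f. f holomorphic_on UNIV \<Longrightarrow> fock_energy \<alpha> m f < \<infinity> \<Longrightarrow>
        fock_energy \<alpha> m (f \<circ> \<phi>) \<le> ennreal K * fock_energy \<alpha> m f"
      by blast
    have into: "f \<circ> \<phi> \<in> fock_space \<alpha> m" if "f \<in> fock_space \<alpha> m" for f
      using K[of f] that hol[of f]
      by (auto simp: space ennreal_mult_less_top intro: le_less_trans)
    have "fock_norm \<alpha> m (f \<circ> \<phi>) \<le> sqrt (max 0 K) * fock_norm \<alpha> m f" if f: "f \<in> fock_space \<alpha> m" for f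
    proof -
      have "fock_energy \<alpha> m (f \<circ> \<phi>) \<le> ennreal (max 0 K) * fock_energy \<alpha> m f"
        using K[of f] f by (simp add: space ennreal_max_0)
      then have "enn2real (fock_energy \<alpha> m (f \<circ> \<phi>)) \<le> max 0 K * enn2real (fock_energy \<alpha> m f)"
        using f enn2real_mono[of "fock_energy \<alpha> m (f \<circ> \<phi>)" "ennreal (max 0 K) * fock_energy \<alpha> m f"]
        by (simp add: space enn2real_mult ennreal_mult_less_top)
      then have "c * enn2real (fock_energy \<alpha> m (f \<circ> \<phi>)) \<le> max 0 K * (c * enn2real (fock_energy \<alpha> m f))"
        using c by simp
      then show ?thesis
        using f by (simp add: space norm hol real_sqrt_mult[symmetric])
    qed
    then have "\<exists>K. \<forall>f\<in>fock_space \<alpha> m. fock_norm \<alpha> m (f \<circ> \<phi>) \<le> K * fock_norm \<alpha> m f"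
      by blast
    with into show ?L
      unfolding bounded_on_fock_def comp_op_def by (auto simp: o_def)
  qed
qed

section \<open>Transporting the weight\<close>

text \<open>The change of variables \<open>w = a + l z\<close>, which moves the map \<open>\<phi>\<close> from the function to the weight.\<close>

lemma fock_energy_comp_affine:
  assumes l: "l \<noteq> 0" and f: "f holomorphic_on UNIV"
  shows "fock_energy \<alpha> m (\<lambda>z. f (a + l * z)) = ennreal (1 / (cmod l)\<^sup>2) *
    (\<integral>\<^sup>+w. ennreal ((cmod (f w))\<^sup>2 * exp (- \<alpha> * (cmod (w - a) / cmod l) powr m)) \<partial>lborel)"
proof -
  note [measurable] = borel_measurable_entire[OF f]
  define G where "G = (\<lambda>w. ennreal ((cmod (f w))\<^sup>2 * exp (- \<alpha> * (cmod (w - a) / cmod l) powr m)))"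
  have [measurable]: "G \<in> borel_measurable borel"
    unfolding G_def by measurable
  have "fock_energy \<alpha> m (\<lambda>z. f (a + l * z)) = (\<integral>\<^sup>+z. G (a + l * z) \<partial>lborel)"
    using l by (simp add: fock_energy_def G_def norm_mult)
  also have "\<dots> = ennreal (1 / (cmod l)\<^sup>2) * (\<integral>\<^sup>+w. G (a + w) \<partial>lborel)"
    by (rule nn_integral_lborel_complex_mult[OF _ l]) measurable
  also have "(\<integral>\<^sup>+w. G (a + w) \<partial>lborel) = (\<integral>\<^sup>+w. G w \<partial>lborel)"
    by (rule nn_integral_lborel_translate) measurable
  finally show ?thesis unfolding G_def .
qed

text \<open>The sufficient condition: a bound for the difference of the exponents bounds the ratio of the
  two weights.\<close>

lemma fock_energy_comp_affine_le:
  assumes l: "l \<noteq> 0" and f: "f holomorphic_on UNIV" and \<alpha>: "\<alpha> > 0"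
    and C: "\<And>w. cmod w powr m \<le> (cmod (w - a) / cmod l) powr m + C"
  shows "fock_energy \<alpha> m (\<lambda>z. f (a + l * z)) \<le> ennreal (exp (\<alpha> * C) / (cmod l)\<^sup>2) * fock_energy \<alpha> m f"
proof -
  note [measurable] = borel_measurable_entire[OF f]
  have "exp (- \<alpha> * (cmod (w - a) / cmod l) powr m) \<le> exp (\<alpha> * C) * exp (- \<alpha> * cmod w powr m)" for w
    using mult_left_mono[OF C[of w], of \<alpha>] \<alpha> by (simp add: exp_add[symmetric] algebra_simps)
  then have "(\<integral>\<^sup>+w. ennreal ((cmod (f w))\<^sup>2 * exp (- \<alpha> * (cmod (w - a) / cmod l) powr m)) \<partial>lborel)
      \<le> (\<integral>\<^sup>+w. ennreal (exp (\<alpha> * C)) * ennreal ((cmod (f w))\<^sup>2 * exp (- \<alpha> * cmod w powr m)) \<partial>lborel)"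
    by (intro nn_integral_mono)
       (simp add: ennreal_mult[symmetric] mult.left_commute[of "exp _"] ennreal_leI mult_left_mono)
  also have "\<dots> = ennreal (exp (\<alpha> * C)) * fock_energy \<alpha> m f"
    unfolding fock_energy_def by (rule nn_integral_cmult) measurable
  finally have "fock_energy \<alpha> m (\<lambda>z. f (a + l * z)) \<le>
      ennreal (1 / (cmod l)\<^sup>2) * (ennreal (exp (\<alpha> * C)) * fock_energy \<alpha> m f)"
    unfolding fock_energy_comp_affine[OF l f] by (rule mult_left_mono) simp
  then show ?thesis
    by (simp add: mult.assoc[symmetric] ennreal_mult[symmetric])
qed

section \<open>Finite energy of monomials and bounded point evaluations\<close>

lemma power_times_exp_powr_bound:
  fixes \<alpha> m :: real
  assumes "\<alpha> > 0" "m > 0"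
  obtains C where "\<And>r. r \<ge> 0 \<Longrightarrow> r ^ k * exp (- \<alpha> * r powr m) \<le> C / (1 + r) ^ 4" 
proof -
  have "((\<lambda>r. r ^ k * (1 + r) ^ 4 * exp (- \<alpha> * r powr m)) \<longlongrightarrow> 0) at_top"
    using assms by real_asymp
  then have "eventually (\<lambda>r. r ^ k * (1 + r) ^ 4 * exp (- \<alpha> * r powr m) < 1) at_top"
    by (rule order_tendstoD) simp
  then obtain R0 where R0: "\<And>r. r \<ge> R0 \<Longrightarrow> r ^ k * (1 + r) ^ 4 * exp (- \<alpha> * r powr m) < 1"
    by (auto simp: eventually_at_top_linorder)
  define R where "R = max R0 0"
  define C where "C = 1 + R ^ k * (1 + R) ^ 4"
  have "r ^ k * (1 + r) ^ 4 * exp (- \<alpha> * r powr m) \<le> C" if r: "r \<ge> 0" for r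
  proof (cases "r \<ge> R")
    case True
    then show ?thesis
      using R0[of r] by (simp add: C_def R_def add_increasing2 less_imp_le)
  next
    case False
    have "r ^ k * (1 + r) ^ 4 * exp (- \<alpha> * r powr m) \<le> R ^ k * (1 + R) ^ 4 * 1"
      using r False assms by (intro mult_mono power_mono) auto
    then show ?thesis
      by (simp add: C_def)
  qed
  then have "r ^ k * exp (- \<alpha> * r powr m) \<le> C / (1 + r) ^ 4" if "r \<ge> 0" for r
    using that by (simp add: pos_le_divide_eq mult_ac)
  then show ?thesis by (rule that)
qed

text \<open>The integrand is dominated by a sum of multiples of indicators of discs: on
  \<open>k \<le> |z| < k + 1\<close> it is at most \<open>1 / (k + 1)^4\<close>, and weighting the whole disc of radius \<open>k + 1\<close>
  by this value costs only \<open>\<pi> / (k + 1)\<^sup>2\<close>.\<close>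

lemma nn_integral_inverse_fourth_power_finite:
  "(\<integral>\<^sup>+z. ennreal (1 / (1 + cmod z) ^ 4) \<partial>lborel) < \<infinity>"
proof -
  have "(\<integral>\<^sup>+z. ennreal (1 / (1 + cmod z) ^ 4) \<partial>lborel) \<le>
    (\<integral>\<^sup>+z. (\<Sum>k. ennreal (1 / (real k + 1) ^ 4) * indicator (ball (0::complex) (real k + 1)) z) \<partial>lborel)"
  proof (rule nn_integral_mono)
    fix z :: complex
    let ?f = "\<lambda>k. ennreal (1 / (real k + 1) ^ 4) * indicator (ball (0::complex) (real k + 1)) z"
    define k where "k = nat \<lfloor>cmod z\<rfloor>"
    have k: "real k \<le> cmod z" "cmod z < real k + 1"
      unfolding k_def by (simp_all add: of_nat_floor)
    have "ennreal (1 / (1 + cmod z) ^ 4) \<le> ?f k"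
      using k by (auto simp: indicator_def intro!: ennreal_leI divide_left_mono power_mono)
    also have "\<dots> = sum ?f {k}"
      by (simp only: sum.insert finite.emptyI empty_iff not_False_eq_True sum.empty add_0_right)
    also have "\<dots> \<le> suminf ?f"
      by (rule sum_le_suminf) (simp_all add: summableI)
    finally show "ennreal (1 / (1 + cmod z) ^ 4) \<le> suminf ?f" .
  qed
  also have "\<dots> = (\<Sum>k. \<integral>\<^sup>+z. ennreal (1 / (real k + 1) ^ 4) * indicator (ball (0::complex) (real k + 1)) z \<partial>lborel)"
    by (rule nn_integral_suminf) (auto intro!: borel_measurable_times_ennreal borel_measurable_indicator)
  also have "\<dots> = (\<Sum>k. ennreal (pi * (1 / (real k + 1)\<^sup>2)))"
    by (intro suminf_cong)
       (simp add: nn_integral_cmult_indicator emeasure_ball unit_ball_vol_2 ennreal_mult[symmetric] eval_nat_numeral)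
  also have "\<dots> < \<infinity>"
  proof -
    have "summable (\<lambda>k. pi * (1 / (real k + 1)\<^sup>2))"
      using inverse_squares_sums by (intro summable_mult) (auto simp: sums_iff add.commute)
    then have "(\<Sum>k. ennreal (pi * (1 / (real k + 1)\<^sup>2))) \<noteq> top"
      by (rule ennreal_suminf_neq_top) simp
    then show ?thesis
      by (simp only: infinity_ennreal_def less_top)
  qed
  finally show ?thesis .
qed

lemma fock_energy_monomial_finite:
  assumes "\<alpha> > 0" "m > 0"
  shows "fock_energy \<alpha> m (\<lambda>z. z ^ n) < \<infinity>"
proof -
  obtain C where C: "\<And>r. r \<ge> 0 \<Longrightarrow> r ^ (n * 2) * exp (- \<alpha> * r powr m) \<le> C / (1 + r) ^ 4"
    using power_times_exp_powr_bound[OF assms] by blast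
  have "C \<ge> 0"
    using C[of 0] by (cases n) auto
  have "fock_energy \<alpha> m (\<lambda>z. z ^ n) \<le> (\<integral>\<^sup>+z. ennreal C * ennreal (1 / (1 + cmod z) ^ 4) \<partial>lborel)"
    unfolding fock_energy_def using C \<open>C \<ge> 0\<close>
    by (intro nn_integral_mono) (auto simp: ennreal_mult[symmetric] norm_power power_mult[symmetric] intro!: ennreal_leI)
  also have "\<dots> = ennreal C * (\<integral>\<^sup>+z. ennreal (1 / (1 + cmod z) ^ 4) \<partial>lborel)"
    by (rule nn_integral_cmult) measurable
  also have "\<dots> < \<infinity>"
    using nn_integral_inverse_fourth_power_finite by (simp add: ennreal_mult_less_top)
  finally show ?thesis .
qed

text \<open>Point evaluation is bounded: apply the area mean value inequality to \<open>f\<^sup>2\<close>, and use that the weight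
  is bounded below on the unit disc about \<open>a\<close>.\<close>

lemma fock_energy_const_le:
  assumes "\<alpha> > 0" "m > 0" and f: "f holomorphic_on UNIV"
  shows "fock_energy \<alpha> m (\<lambda>z. f a) \<le>
    ennreal (exp (\<alpha> * (cmod a + 1) powr m) / pi * enn2real (fock_energy \<alpha> m (\<lambda>z. 1))) * fock_energy \<alpha> m f"
proof -
  note [measurable] = borel_measurable_entire[OF f]
  define e where "e = enn2real (fock_energy \<alpha> m (\<lambda>z. 1))"
  define E where "E = exp (\<alpha> * (cmod a + 1) powr m)"
  have e: "fock_energy \<alpha> m (\<lambda>z. 1) = ennreal e"
    using fock_energy_monomial_finite[OF assms(1,2), of 0] by (simp add: e_def)
  have "e \<ge> 0" "E > 0"
    by (simp_all add: e_def E_def)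
  have weight: "1 \<le> E * exp (- \<alpha> * cmod z powr m)" if z: "z \<in> ball a 1" for z
  proof -
    have "cmod z \<le> cmod a + 1"
      using z norm_triangle_ineq2[of z a] by (simp add: dist_norm norm_minus_commute)
    then have "\<alpha> * cmod z powr m \<le> \<alpha> * (cmod a + 1) powr m"
      using assms by (intro mult_left_mono powr_mono2) auto
    then show ?thesis
      unfolding E_def by (simp add: exp_add[symmetric])
  qed
  have "ennreal pi * ennreal ((cmod (f a))\<^sup>2) = ennreal pi * ennreal (cmod ((f a)\<^sup>2))"
    by (simp add: norm_power)
  also have "\<dots> \<le> (\<integral>\<^sup>+z. indicator (ball a 1) z * ennreal (cmod ((f z)\<^sup>2)) \<partial>lborel)"
    by (rule norm_le_nn_integral_ball) (intro holomorphic_intros f)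
  also have "\<dots> \<le> (\<integral>\<^sup>+z. ennreal E * ennreal ((cmod (f z))\<^sup>2 * exp (- \<alpha> * cmod z powr m)) \<partial>lborel)"
  proof (rule nn_integral_mono)
    fix z
    show "indicator (ball a 1) z * ennreal (cmod ((f z)\<^sup>2)) \<le>
      ennreal E * ennreal ((cmod (f z))\<^sup>2 * exp (- \<alpha> * cmod z powr m))"
    proof (cases "z \<in> ball a 1")
      case True
      have "(cmod (f z))\<^sup>2 * 1 \<le> (cmod (f z))\<^sup>2 * (E * exp (- \<alpha> * cmod z powr m))"
        using weight[OF True] by (rule mult_left_mono) simp
      with \<open>E > 0\<close> True show ?thesis
        by (simp add: ennreal_mult[symmetric] norm_power mult_ac ennreal_leI)
    qed (simp add: indicator_def)
  qed
  also have "\<dots> = ennreal E * fock_energy \<alpha> m f"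
    unfolding fock_energy_def by (rule nn_integral_cmult) measurable
  finally have *: "ennreal pi * ennreal ((cmod (f a))\<^sup>2) \<le> ennreal E * fock_energy \<alpha> m f" .
  have "fock_energy \<alpha> m (\<lambda>z. f a) = ennreal ((cmod (f a))\<^sup>2) * fock_energy \<alpha> m (\<lambda>z. 1)"
    unfolding fock_energy_def by (simp add: ennreal_mult nn_integral_cmult)
  also have "\<dots> = ennreal (e / pi) * (ennreal pi * ennreal ((cmod (f a))\<^sup>2))"
    using \<open>e \<ge> 0\<close> by (simp add: e ennreal_mult[symmetric])
  also have "\<dots> \<le> ennreal (e / pi) * (ennreal E * fock_energy \<alpha> m f)"
    using * by (rule mult_left_mono) simp
  also have "\<dots> = ennreal (E / pi * e) * fock_energy \<alpha> m f"
    using \<open>e \<ge> 0\<close> \<open>E > 0\<close>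
    by (simp add: mult.assoc[symmetric] ennreal_mult[symmetric]) (simp add: mult.commute)
  finally show ?thesis unfolding e_def E_def .
qed

section \<open>Comparing the exponents of the weights\<close>

text \<open>For \<open>s = x + y\<close> the fractions \<open>x / s\<close> and \<open>y / s\<close> lie in \<open>[0, 1]\<close>, where \<open>t \<le> t^m\<close>, and they add
  up to 1.\<close>

lemma powr_add_le_add_powr:
  fixes x y m :: real
  assumes "0 \<le> x" "0 \<le> y" "0 < m" "m \<le> 1"
  shows "(x + y) powr m \<le> x powr m + y powr m"
proof (cases "x + y = 0")
  case False
  define s where "s = x + y"
  have s: "s > 0" using False assms by (simp add: s_def)
  have le: "t / s \<le> (t / s) powr m" if "0 \<le> t" "t \<le> s" for t
    using powr_mono'[of m 1 "t / s"] that s assms by simp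
  have "1 = x / s + y / s"
    using s by (simp add: s_def add_divide_distrib[symmetric])
  also have "\<dots> \<le> (x / s) powr m + (y / s) powr m"
    using assms by (intro add_mono le) (auto simp: s_def)
  also have "\<dots> = (x powr m + y powr m) / s powr m"
    using assms s by (simp add: powr_divide add_divide_distrib)
  finally show ?thesis
    using s by (simp add: pos_le_divide_eq s_def[symmetric])
qed (use assms in auto)

lemma weight_comparison_concave:
  fixes w a :: complex
  assumes "0 < m" "m \<le> 1" "0 < L" "L \<le> 1"
  shows "cmod w powr m \<le> (cmod (w - a) / L) powr m + cmod a powr m"
proof -
  have "cmod w powr m \<le> (cmod (w - a) + cmod a) powr m"
    using assms norm_triangle_ineq[of "w - a" a] by (intro powr_mono2) auto
  also have "\<dots> \<le> cmod (w - a) powr m + cmod a powr m"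
    using assms by (intro powr_add_le_add_powr) auto
  also have "cmod (w - a) powr m \<le> (cmod (w - a) / L) powr m"
    using assms by (intro powr_mono2) (auto simp: pos_le_divide_eq mult_left_le)
  finally show ?thesis by simp
qed

text \<open>Outside the disc of radius \<open>|a| / (1 - L)\<close> the contraction beats the translation, that is
  \<open>|w - a| / L \<ge> |w|\<close>; inside it the left side is bounded by the constant.\<close>

lemma weight_comparison_contraction:
  fixes w a :: complex
  assumes "0 < m" "0 < L" "L < 1"
  shows "cmod w powr m \<le> (cmod (w - a) / L) powr m + (cmod a / (1 - L)) powr m"
proof (cases "cmod w \<le> cmod a / (1 - L)")
  case True
  then have "cmod w powr m \<le> (cmod a / (1 - L)) powr m"
    using assms by (intro powr_mono2) auto
  then show ?thesis by (simp add: add_increasing)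
next
  case False
  then have "cmod w * L \<le> cmod w - cmod a"
    using assms by (simp add: not_le pos_divide_less_eq algebra_simps)
  also have "\<dots> \<le> cmod (w - a)"
    by (rule norm_triangle_ineq2)
  finally have "cmod w powr m \<le> (cmod (w - a) / L) powr m"
    using assms by (intro powr_mono2) (auto simp: pos_le_divide_eq)
  then show ?thesis by (simp add: add_increasing2)
qed

lemma weight_gap_expansion:
  fixes m L c :: real
  assumes "0 < m" "1 < L" "0 \<le> c"
  shows "filterlim (\<lambda>r. r powr m - ((r - c) / L) powr m) at_top at_top"
proof (rule filterlim_at_top_mono)
  have "L powr m > 1"
    using assms by (intro gr_one_powr) auto
  then have "1 - 1 / L powr m > 0" using assms by simp
  then show "filterlim (\<lambda>r. (1 - 1 / L powr m) * r powr m) at_top at_top"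
    using assms(1) by real_asymp
  show "eventually (\<lambda>r. (1 - 1 / L powr m) * r powr m \<le> r powr m - ((r - c) / L) powr m) at_top"
    using eventually_ge_at_top[of c]
  proof eventually_elim
    case (elim r)
    have "((r - c) / L) powr m \<le> (r / L) powr m"
      using assms elim by (intro powr_mono2 divide_right_mono) auto
    also have "\<dots> = r powr m / L powr m"
      using assms elim by (simp add: powr_divide)
    finally show ?case by (simp add: algebra_simps)
  qed
qed

text \<open>Here \<open>m > 1\<close> is essential: the gap grows at least like \<open>c (r - c)^(m - 1)\<close>, as one sees from
  \<open>r^m \<ge> r (r - c)^(m - 1)\<close>.\<close>

lemma weight_gap_translation:
  fixes m c :: real
  assumes "1 < m" "0 < c"
  shows "filterlim (\<lambda>r. r powr m - (r - c) powr m) at_top at_top"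
proof (rule filterlim_at_top_mono)
  show "filterlim (\<lambda>r. c * (r - c) powr (m - 1)) at_top at_top"
    using assms by real_asymp
  show "eventually (\<lambda>r. c * (r - c) powr (m - 1) \<le> r powr m - (r - c) powr m) at_top"
    using eventually_gt_at_top[of c]
  proof eventually_elim
    case (elim r)
    have split: "x powr m = x * x powr (m - 1)" if "x > 0" for x :: real
      using that by (simp add: powr_mult_base)
    have "r * (r - c) powr (m - 1) \<le> r * r powr (m - 1)"
      using assms elim by (intro mult_left_mono powr_mono2) auto
    then show ?case
      using split[of r] split[of "r - c"] assms elim by (simp add: algebra_simps)
  qed
qed

section \<open>Monomials as test functions\<close>

text \<open>Among the four numbers \<open>Re (u w cnj a)\<close>, which are plus and minus the real and imaginary part of
  \<open>w cnj a\<close>, one is at least half of \<open>|w| |a|\<close>. The law of cosines then bounds \<open>|u w - a|\<close>.\<close>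

lemma rotation_towards:
  fixes w a :: complex
  assumes "2 * cmod a \<le> cmod w"
  shows "\<exists>u\<in>{1, \<i>, -1, -\<i>}. cmod (u * w - a) \<le> cmod w - cmod a / 4"
proof -
  let ?q = "w * cnj a"
  have "cmod w * cmod a \<le> \<bar>Re ?q\<bar> + \<bar>Im ?q\<bar>"
    using cmod_le[of ?q] by (simp only: norm_mult complex_mod_cnj)
  then have "cmod w * cmod a / 2 \<le> Re ?q \<or> cmod w * cmod a / 2 \<le> - Im ?q \<or>
      cmod w * cmod a / 2 \<le> - Re ?q \<or> cmod w * cmod a / 2 \<le> Im ?q"
    by linarith
  moreover have "Re (1 * ?q) = Re ?q" "Re (\<i> * ?q) = - Im ?q" "Re (- 1 * ?q) = - Re ?q"
      "Re (- \<i> * ?q) = Im ?q"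
    by simp_all
  ultimately have "\<exists>u\<in>{1, \<i>, -1, -\<i>}. cmod w * cmod a / 2 \<le> Re (u * ?q)"
    by (metis insert_iff)
  then obtain u where u: "u \<in> {1, \<i>, -1, -\<i>}" "cmod w * cmod a / 2 \<le> Re (u * ?q)"
    by blast
  have "cmod u = 1" using u(1) by auto
  have norm_diff: "(cmod (v - a))\<^sup>2 = (cmod v)\<^sup>2 + (cmod a)\<^sup>2 - 2 * Re (v * cnj a)" for v
    by (simp add: cmod_power2 power2_diff)
  have "(cmod (u * w - a))\<^sup>2 = (cmod w)\<^sup>2 + (cmod a)\<^sup>2 - 2 * Re (u * ?q)"
    using \<open>cmod u = 1\<close> norm_diff[of "u * w"] by (simp add: norm_mult mult.assoc)
  also have "\<dots> \<le> (cmod w)\<^sup>2 + (cmod a)\<^sup>2 - cmod w * cmod a"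
    using u(2) by simp
  also have "\<dots> \<le> (cmod w - cmod a / 4)\<^sup>2"
  proof -
    have "(cmod a) * (2 * cmod a) \<le> cmod a * cmod w"
      using assms by (intro mult_left_mono) auto
    then have "(cmod a)\<^sup>2 \<le> cmod w * cmod a / 2"
      by (simp add: power2_eq_square mult.commute)
    moreover have "(cmod w - cmod a / 4)\<^sup>2 = (cmod w)\<^sup>2 - cmod w * cmod a / 2 + (cmod a)\<^sup>2 / 16"
      by (simp add: power2_diff power_divide)
    ultimately show ?thesis
      using zero_le_power2[of "cmod a"] by linarith
  qed
  finally have "cmod (u * w - a) \<le> cmod w - cmod a / 4"
  proof (rule power2_le_imp_le)
    show "0 \<le> cmod w - cmod a / 4"
      using assms norm_ge_zero[of a] by linarith
  qed
  with u(1) show ?thesis by blast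
qed

text \<open>Suppose a bound \<open>k\<close> held for all monomials. Averaging over the four rotations and using the gap, the
  part of the energy of \<open>z ^ n\<close> outside a disc of radius \<open>R\<close> would be at most \<open>k\<close> times the part
  inside. But the inner part is \<open>O(R^(2n))\<close>, whereas the outer one is at least a constant times
  \<open>(2R)^(2n)\<close>.\<close>

lemma fock_energy_comp_affine_monomials_unbounded:
  assumes \<alpha>: "\<alpha> > 0" and m: "m > 0" and l: "l \<noteq> 0"
    and gap: "filterlim (\<lambda>r. r powr m - ((r - cmod a / 4) / cmod l) powr m) at_top at_top"
  shows "\<exists>n. ennreal K * fock_energy \<alpha> m (\<lambda>z. z ^ n) < fock_energy \<alpha> m (\<lambda>z. (a + l * z) ^ n)"
proof (rule ccontr)
  assume "\<not> ?thesis"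
  then have bdd: "fock_energy \<alpha> m (\<lambda>z. (a + l * z) ^ n) \<le> ennreal K * fock_energy \<alpha> m (\<lambda>z. z ^ n)" for n
    by (simp add: not_less)
  define k where "k = max 0 K"
  have k: "k \<ge> 0" "ennreal K = ennreal k"
    by (simp_all add: k_def ennreal_max_0)
  \<comment> \<open>The factor 4 pays for the number of rotations, and \<open>k + 1\<close> instead of \<open>k\<close> makes the outer part absorbable.\<close>
  define B where "B = 4 * (cmod l)\<^sup>2 * (k + 1)"
  have "B > 0" using l k by (simp add: B_def)
  define W where "W = (\<lambda>w. exp (- \<alpha> * cmod w powr m))"
  define V where "V = (\<lambda>w. exp (- \<alpha> * (cmod (w - a) / cmod l) powr m))"
  have [measurable]: "W \<in> borel_measurable borel" "V \<in> borel_measurable borel"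
    unfolding W_def V_def by measurable
  have pos: "W w > 0" "V w > 0" for w
    by (simp_all add: W_def V_def)
  let ?U = "{1, \<i>, -1, -\<i>}"
  obtain R0 where R0: "\<And>r. r \<ge> R0 \<Longrightarrow> ln B / \<alpha> \<le> r powr m - ((r - cmod a / 4) / cmod l) powr m"
    using gap by (auto simp: filterlim_at_top eventually_at_top_linorder)
  define R where "R = max R0 (max (2 * cmod a) 1)"
  have R: "R \<ge> 2 * cmod a" "R > 0" "R \<ge> R0"
    by (auto simp: R_def)
  have dominate: "B * W w \<le> (\<Sum>u\<in>?U. V (u * w))" if w: "cmod w \<ge> R" for w
  proof -
    obtain u where u: "u \<in> ?U" "cmod (u * w - a) \<le> cmod w - cmod a / 4"
      using rotation_towards[of a w] w R by (meson order_trans)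
    let ?x = "((cmod w - cmod a / 4) / cmod l) powr m"
    have "ln B \<le> \<alpha> * (cmod w powr m - ?x)"
      using R0[of "cmod w"] w R \<alpha> by (simp add: pos_divide_le_eq mult.commute)
    then have "B \<le> exp (\<alpha> * (cmod w powr m - ?x))"
      using \<open>B > 0\<close> by (metis exp_le_cancel_iff exp_ln)
    then have "B * W w \<le> exp (\<alpha> * (cmod w powr m - ?x)) * W w"
      using pos[of w] by (intro mult_right_mono) auto
    also have "\<dots> = exp (- \<alpha> * ?x)"
      by (simp add: W_def exp_add[symmetric] algebra_simps)
    also have "\<dots> \<le> V (u * w)"
    proof -
      have "(cmod (u * w - a) / cmod l) powr m \<le> ?x"
        using u(2) m by (intro powr_mono2 divide_right_mono) auto
      then show ?thesis using \<alpha> by (simp add: V_def)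
    qed
    also have "\<dots> \<le> (\<Sum>u\<in>?U. V (u * w))"
      using u(1) pos by (intro member_le_sum) (auto intro: less_imp_le)
    finally show ?thesis .
  qed
  define e where "e = enn2real (fock_energy \<alpha> m (\<lambda>z. 1))"
  have e: "fock_energy \<alpha> m (\<lambda>z. 1) = ennreal e" "e \<ge> 0"
    using fock_energy_monomial_finite[OF \<alpha> m, of 0] by (simp_all add: e_def)
  define outer where "outer = (\<lambda>n r. \<integral>\<^sup>+w. indicator {w. cmod w \<ge> r} w * ennreal (cmod w ^ (2 * n) * W w) \<partial>lborel)"
  define inner where "inner = (\<lambda>n. \<integral>\<^sup>+w. indicator {w. cmod w < R} w * ennreal (cmod w ^ (2 * n) * W w) \<partial>lborel)"
  have energy: "fock_energy \<alpha> m (\<lambda>z. z ^ n) = (\<integral>\<^sup>+w. ennreal (cmod w ^ (2 * n) * W w) \<partial>lborel)" for n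
    unfolding fock_energy_def W_def by (simp add: norm_power power_mult[symmetric] mult.commute)
  have split: "fock_energy \<alpha> m (\<lambda>z. z ^ n) = outer n R + inner n" for n
  proof -
    have "outer n R + inner n = (\<integral>\<^sup>+w. indicator {w. cmod w \<ge> R} w * ennreal (cmod w ^ (2 * n) * W w)
        + indicator {w. cmod w < R} w * ennreal (cmod w ^ (2 * n) * W w) \<partial>lborel)"
      unfolding outer_def inner_def by (rule nn_integral_add[symmetric]) measurable
    also have "\<dots> = fock_energy \<alpha> m (\<lambda>z. z ^ n)"
      unfolding energy by (intro nn_integral_cong) (auto simp: indicator_def)
    finally show ?thesis by simp
  qed
  \<comment> \<open>Each rotation contributes the same integral \<open>J\<close>, because \<open>|w| ^ (2 n)\<close> is radial.\<close>
  have outer_le: "ennreal (k + 1) * outer n R \<le> ennreal k * fock_energy \<alpha> m (\<lambda>z. z ^ n)" for n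
  proof -
    define J where "J = (\<integral>\<^sup>+w. ennreal (cmod w ^ (2 * n) * V w) \<partial>lborel)"
    have J: "fock_energy \<alpha> m (\<lambda>z. (a + l * z) ^ n) = ennreal (1 / (cmod l)\<^sup>2) * J"
      unfolding J_def V_def
      by (subst fock_energy_comp_affine[OF l, of "\<lambda>z. z ^ n"])
         (auto intro!: holomorphic_intros simp: norm_power power_mult[symmetric] mult.commute)
    have "ennreal B * outer n R =
        (\<integral>\<^sup>+w. ennreal B * (indicator {w. cmod w \<ge> R} w * ennreal (cmod w ^ (2 * n) * W w)) \<partial>lborel)"
      unfolding outer_def by (rule nn_integral_cmult[symmetric]) measurable
    also have "\<dots> \<le> (\<integral>\<^sup>+w. (\<Sum>u\<in>?U. ennreal (cmod (u * w) ^ (2 * n) * V (u * w))) \<partial>lborel)"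
    proof (rule nn_integral_mono)
      fix w
      have "B * (cmod w ^ (2 * n) * W w) \<le> (\<Sum>u\<in>?U. cmod (u * w) ^ (2 * n) * V (u * w))" if "cmod w \<ge> R"
      proof -
        have "(\<Sum>u\<in>?U. cmod (u * w) ^ (2 * n) * V (u * w)) = cmod w ^ (2 * n) * (\<Sum>u\<in>?U. V (u * w))"
          unfolding sum_distrib_left by (intro sum.cong) (auto simp: norm_mult)
        then show ?thesis
          using mult_left_mono[OF dominate[OF that], of "cmod w ^ (2 * n)"] by (simp add: mult_ac)
      qed
      moreover have "(\<Sum>u\<in>?U. ennreal (cmod (u * w) ^ (2 * n) * V (u * w)))
          = ennreal (\<Sum>u\<in>?U. cmod (u * w) ^ (2 * n) * V (u * w))"
        by (intro sum_ennreal mult_nonneg_nonneg zero_le_power norm_ge_zero less_imp_le[OF pos(2)])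
      ultimately show "ennreal B * (indicator {w. cmod w \<ge> R} w * ennreal (cmod w ^ (2 * n) * W w))
          \<le> (\<Sum>u\<in>?U. ennreal (cmod (u * w) ^ (2 * n) * V (u * w)))"
        using \<open>B > 0\<close> by (cases "cmod w \<ge> R") (auto simp: ennreal_mult'[symmetric] simp del: sum.insert intro: ennreal_leI)
    qed
    also have "\<dots> = (\<Sum>u\<in>?U. \<integral>\<^sup>+w. ennreal (cmod (u * w) ^ (2 * n) * V (u * w)) \<partial>lborel)"
      by (rule nn_integral_sum) measurable
    also have "\<dots> = (\<Sum>u\<in>?U. J)"
    proof (rule sum.cong[OF refl])
      fix u assume "u \<in> ?U"
      then have "cmod u = 1" "u \<noteq> 0" by auto
      then show "(\<integral>\<^sup>+w. ennreal (cmod (u * w) ^ (2 * n) * V (u * w)) \<partial>lborel) = J"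
        unfolding J_def
        by (subst nn_integral_lborel_complex_mult[of "\<lambda>w. ennreal (cmod w ^ (2 * n) * V w)" u])
           simp_all
    qed
    also have "\<dots> = ennreal (4 * (cmod l)\<^sup>2) * (ennreal (1 / (cmod l)\<^sup>2) * J)"
      using l by (simp add: mult.assoc[symmetric] ennreal_mult'[symmetric] complex_eq_iff)
    also have "\<dots> \<le> ennreal (4 * (cmod l)\<^sup>2) * (ennreal k * fock_energy \<alpha> m (\<lambda>z. z ^ n))"
      using bdd[of n] unfolding J k(2) by (rule mult_left_mono) simp
    finally have "ennreal (4 * (cmod l)\<^sup>2) * (ennreal (k + 1) * outer n R)
        \<le> ennreal (4 * (cmod l)\<^sup>2) * (ennreal k * fock_energy \<alpha> m (\<lambda>z. z ^ n))"
      using k by (simp add: B_def ennreal_mult' mult.assoc)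
    then show ?thesis
      using l by (subst (asm) ennreal_mult_le_mult_iff) auto
  qed
  \<comment> \<open>Subtracting \<open>k\<close> times the outer part is legitimate since all energies of monomials are finite.\<close>
  have outer_le_inner: "outer n R \<le> ennreal k * inner n" for n
  proof -
    have "outer n R + inner n < \<infinity>"
      using fock_energy_monomial_finite[OF \<alpha> m, of n] by (simp add: split)
    then obtain x y where xy: "outer n R = ennreal x" "inner n = ennreal y" "x \<ge> 0" "y \<ge> 0"
      by (metis ennreal_cases ennreal_add_eq_top infinity_ennreal_def less_irrefl)
    have "ennreal ((k + 1) * x) \<le> ennreal (k * (x + y))"
      using outer_le[of n] k xy by (simp add: split ennreal_mult ennreal_plus)
    then have "x \<le> k * y"
      using k xy by (subst (asm) ennreal_le_iff) (auto simp: algebra_simps)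
    then show ?thesis
      using k xy by (simp add: ennreal_mult[symmetric] ennreal_leI)
  qed
  have inner_le: "inner n \<le> ennreal (R ^ (2 * n) * e)" for n
  proof -
    have "inner n \<le> (\<integral>\<^sup>+w. ennreal (R ^ (2 * n)) * ennreal (cmod w ^ (2 * 0) * W w) \<partial>lborel)"
      unfolding inner_def using R pos
      by (intro nn_integral_mono)
         (auto simp: indicator_def ennreal_mult'[symmetric] less_imp_le intro!: ennreal_leI mult_right_mono power_mono)
    also have "\<dots> = ennreal (R ^ (2 * n)) * fock_energy \<alpha> m (\<lambda>z. z ^ 0)"
      unfolding energy by (rule nn_integral_cmult) measurable
    also have "\<dots> = ennreal (R ^ (2 * n) * e)"
      using e R by (simp add: ennreal_mult)
    finally show ?thesis .
  qed
  \<comment> \<open>A lower bound for the weighted area of a disc of radius \<open>R\<close> in the annulus \<open>2 R \<le> |w| \<le> 4 R\<close>.\<close>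
  define \<tau> where "\<tau> = exp (- \<alpha> * (4 * R) powr m) * (pi * R\<^sup>2)"
  have "\<tau> > 0" using R by (simp add: \<tau>_def)
  have outer_ge: "ennreal ((2 * R) ^ (2 * n) * \<tau>) \<le> outer n R" for n
  proof -
    let ?D = "ball (complex_of_real (3 * R)) R"
    have far: "2 * R \<le> cmod w" "cmod w \<le> 4 * R" if "w \<in> ?D" for w
      using that R norm_triangle_ineq2[of "complex_of_real (3 * R)" w]
        norm_triangle_ineq2[of w "complex_of_real (3 * R)"]
      by (auto simp: dist_norm norm_minus_commute)
    have "ennreal ((2 * R) ^ (2 * n) * \<tau>) =
        (\<integral>\<^sup>+w. ennreal ((2 * R) ^ (2 * n) * exp (- \<alpha> * (4 * R) powr m)) * indicator ?D w \<partial>lborel)"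
      using R by (subst nn_integral_cmult_indicator)
        (simp_all add: emeasure_ball unit_ball_vol_2 \<tau>_def ennreal_mult'[symmetric] mult_ac)
    also have "\<dots> \<le> outer n R"
      unfolding outer_def
    proof (rule nn_integral_mono)
      fix w
      have "(2 * R) ^ (2 * n) * exp (- \<alpha> * (4 * R) powr m) \<le> cmod w ^ (2 * n) * W w" if "w \<in> ?D"
        using far[OF that] R m \<alpha> unfolding W_def
        by (intro mult_mono power_mono) (auto intro!: powr_mono2)
      moreover have "R \<le> cmod w" if "w \<in> ?D"
        using far[OF that] R by simp
      ultimately show "ennreal ((2 * R) ^ (2 * n) * exp (- \<alpha> * (4 * R) powr m)) * indicator ?D w
          \<le> indicator {w. cmod w \<ge> R} w * ennreal (cmod w ^ (2 * n) * W w)"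
        by (auto simp: indicator_def intro!: ennreal_leI)
    qed
    finally show ?thesis .
  qed
  have "4 ^ n * \<tau> \<le> k * e" for n
  proof -
    have "ennreal ((2 * R) ^ (2 * n) * \<tau>) \<le> ennreal k * ennreal (R ^ (2 * n) * e)"
      using outer_ge[of n] outer_le_inner[of n] mult_left_mono[OF inner_le[of n], of "ennreal k"]
      by (meson order_trans zero_le)
    then have "(2 * R) ^ (2 * n) * \<tau> \<le> k * (R ^ (2 * n) * e)"
      using k e R by (simp add: ennreal_mult[symmetric] ennreal_le_iff)
    moreover have "(2 * R) ^ (2 * n) = R ^ (2 * n) * 4 ^ n"
      unfolding power_mult by (simp add: power_mult_distrib)
    ultimately have "R ^ (2 * n) * (4 ^ n * \<tau>) \<le> R ^ (2 * n) * (k * e)"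
      by (simp only: mult_ac)
    then show ?thesis
      using R by simp
  qed
  moreover obtain n where "k * e / \<tau> < 4 ^ n"
    using real_arch_pow[of 4 "k * e / \<tau>"] by auto
  then have "k * e < 4 ^ n * \<tau>"
    using \<open>\<tau> > 0\<close> by (simp only: pos_divide_less_eq)
  ultimately show False
    by (meson not_less)
qed

section \<open>Boundedness of composition with an affine map\<close>

theorem corollary5p5:
  fixes \<alpha> :: real and \<phi> :: "complex \<Rightarrow> complex" and l :: complex
  assumes "\<alpha> > 0"
    and "\<forall>z. \<phi> z = \<phi> 0 + l * z"
  shows "(\<forall>m::real. 0 < m \<and> m \<le> 1 \<longrightarrow>
            (bounded_on_fock \<alpha> m (comp_op \<phi>) \<longleftrightarrow> cmod l \<le> 1)) \<and>
         (\<forall>m::real. m > 1 \<longrightarrow>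
            (bounded_on_fock \<alpha> m (comp_op \<phi>) \<longleftrightarrow>
               cmod l < 1 \<or> (cmod l = 1 \<and> \<phi> 0 = 0)))"
proof -
  define a where "a = \<phi> 0"
  have \<phi>: "\<phi> = (\<lambda>z. a + l * z)"
    unfolding a_def by (rule ext, rule assms(2)[THEN spec])
  have hol: "\<phi> holomorphic_on UNIV"
    unfolding \<phi> by (intro holomorphic_intros)
  note iff = bounded_on_fock_comp_op_iff[OF \<open>\<alpha> > 0\<close> _ hol]
  have sufficient: "bounded_on_fock \<alpha> m (comp_op \<phi>)"
    if "m > 0" "l \<noteq> 0" and C: "\<And>w. cmod w powr m \<le> (cmod (w - a) / cmod l) powr m + C" for m C
    unfolding iff[OF \<open>m > 0\<close>]
  proof (intro exI allI impI)
    fix f :: "complex \<Rightarrow> complex"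
    assume "f holomorphic_on UNIV"
    from fock_energy_comp_affine_le[OF \<open>l \<noteq> 0\<close> this \<open>\<alpha> > 0\<close> C]
    show "fock_energy \<alpha> m (f \<circ> \<phi>) \<le> ennreal (exp (\<alpha> * C) / (cmod l)\<^sup>2) * fock_energy \<alpha> m f"
      by (simp add: \<phi> o_def)
  qed
  have constant_map: "bounded_on_fock \<alpha> m (comp_op \<phi>)" if "m > 0" "l = 0" for m
    unfolding iff[OF \<open>m > 0\<close>]
    using fock_energy_const_le[OF \<open>\<alpha> > 0\<close> \<open>m > 0\<close>, of _ a] \<open>l = 0\<close>
    by (auto simp: \<phi> o_def)
  have unbounded: "\<not> bounded_on_fock \<alpha> m (comp_op \<phi>)"
    if "m > 0" "l \<noteq> 0"
      and gap: "filterlim (\<lambda>r. r powr m - ((r - cmod a / 4) / cmod l) powr m) at_top at_top" for m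
  proof
    assume "bounded_on_fock \<alpha> m (comp_op \<phi>)"
    then obtain K where K: "\<And>f. f holomorphic_on UNIV \<Longrightarrow> fock_energy \<alpha> m f < \<infinity> \<Longrightarrow>
        fock_energy \<alpha> m (f \<circ> \<phi>) \<le> ennreal K * fock_energy \<alpha> m f"
      unfolding iff[OF \<open>m > 0\<close>] by blast
    obtain n where n: "ennreal K * fock_energy \<alpha> m (\<lambda>z. z ^ n) < fock_energy \<alpha> m (\<lambda>z. (a + l * z) ^ n)"
      using fock_energy_comp_affine_monomials_unbounded[OF \<open>\<alpha> > 0\<close> \<open>m > 0\<close> \<open>l \<noteq> 0\<close> gap]
      by blast
    have "fock_energy \<alpha> m ((\<lambda>z. z ^ n) \<circ> \<phi>) \<le> ennreal K * fock_energy \<alpha> m (\<lambda>z. z ^ n)"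
      by (intro K holomorphic_intros fock_energy_monomial_finite \<open>\<alpha> > 0\<close> \<open>m > 0\<close>)
    with n show False
      by (simp add: \<phi> o_def)
  qed
  have expansion: "\<not> bounded_on_fock \<alpha> m (comp_op \<phi>)" if "m > 0" "cmod l > 1" for m
    using that by (intro unbounded weight_gap_expansion) auto
  have contraction: "bounded_on_fock \<alpha> m (comp_op \<phi>)" if "m > 0" "cmod l < 1" for m
    using that constant_map[of m] sufficient[OF _ _ weight_comparison_contraction[of m "cmod l" _ a]]
    by (cases "l = 0") auto
  show ?thesis
  proof (intro conjI allI impI; (elim conjE)?)
    fix m :: real assume m: "0 < m" "m \<le> 1"
    have "bounded_on_fock \<alpha> m (comp_op \<phi>)" if "cmod l \<le> 1"
      using that m constant_map[of m] sufficient[OF _ _ weight_comparison_concave[of m "cmod l" _ a]]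
      by (cases "l = 0") auto
    then show "bounded_on_fock \<alpha> m (comp_op \<phi>) \<longleftrightarrow> cmod l \<le> 1"
      using expansion[of m] m by fastforce
  next
    fix m :: real assume m: "m > 1"
    have rotation: "bounded_on_fock \<alpha> m (comp_op \<phi>)" if "cmod l = 1" "a = 0"
      using that m by (intro sufficient[of m 0]) auto
    have translation: "\<not> bounded_on_fock \<alpha> m (comp_op \<phi>)" if "cmod l = 1" "a \<noteq> 0"
      using that m weight_gap_translation[of m "cmod a / 4"] by (intro unbounded) auto
    show "bounded_on_fock \<alpha> m (comp_op \<phi>) \<longleftrightarrow> cmod l < 1 \<or> (cmod l = 1 \<and> \<phi> 0 = 0)"
      using rotation translation expansion[of m] contraction[of m] m
      unfolding a_def[symmetric] by (cases "cmod l" "1::real" rule: linorder_cases) auto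
  qed
qed

end
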